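(* Let $R(t)\in \mathrm{SO}(3)$, $\Omega(t)\in\mathbb{R}^3$, $v(t)\in\mathbb{R}^3$ ($t\ge 0$), $g>0$ and $m_{\mathcal I}\in S^2$ be as in the context, with $m_{\mathcal I}$ and $e_3$ non-collinear, $|v(t)|\le v_{max}$ and $|\Omega(t)|\le\Omega_{max}$ for all $t\ge 0$. Let $D(t)=M(t)^\top M(t)\in\mathbb{R}^{6\times 6}$ be the matrix defined in the context, for either one of the two parametrizations ($\tilde\lambda$ or $\bar\lambda$). Assume that there exist $\delta_0>0$ and $\rho>0$ such that $$\frac{1}{\delta_0}\int_t^{t+\delta_0}R_{3,3}^2(s)\,ds\ \ge\ \rho^2\qquad\forall t\ge 0.$$ Then there exist $\delta>0$ and $\mu>0$ such that $$\frac1\delta\int_t^{t+\delta}D(s)\,ds\ \ge\ \mu I_6\qquad\forall t>0$$ in each of the following cases: (1) Motion along the vertical direction: $v(t)\times e_3=0$ for all $t\ge 0$; (2) Pure translation: $\Omega(t)=0$ for all $t\ge 0$; (3) Slow motion such that $v_{max}\,\Omega_{max}\le \dfrac{g\rho^2}{\sqrt 6}$; (4) Persistently accelerated translational motion: there exist $\bar\delta>0$ and $\bar\rho>0$ such that for all $t\ge 0$ $$\min\left(\frac1{\bar\delta}\int_t^{t+\bar\delta}\dot v_1^2(s)\,ds,\ \frac1{\bar\delta}\int_t^{t+\bar\delta}\dot v_2^2(s)\,ds\right)\ \ge\ \bar\rho .$$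
   Context: Notation. $\{e_1,e_2,e_3\}$ is the canonical basis of $\mathbb{R}^3$; $[u]_\times$ is the skew-symmetric matrix with $[u]_\times w=u\times w$ for all $w\in\mathbb{R}^3$; $I_n$ is the $n\times n$ identity matrix; $S^2$ is the unit sphere of $\mathbb{R}^3$; $R_{i,j}$ is the $(i,j)$ entry of $R$; $v_i$ is the $i$-th component of $v$; $|\cdot|$ is the Euclidean norm; for symmetric matrices, $A\ge B$ means that $A-B$ is positive semidefinite. System. $R(t)\in\mathrm{SO}(3)$ is the attitude of a vehicle (rotation of a body-fixed frame relative to an inertial frame), and satisfies $\dot R=R[\Omega]_\times$, where $\Omega(t)\in\mathbb{R}^3$ is the angular velocity in body coordinates. $v(t)\in\mathbb{R}^3$ is the linear velocity expressed in the inertial frame, and $\dot v$ is its time derivative. All functions of time are defined for $t\ge 0$ and regular enough for the expressions below to make sense ($\Omega$ continuous, $v$ continuously differentiable). $g>0$ is the gravity constant. $m_{\mathcal I}\in S^2$ is a constant unit vector (normalized Earth's magnetic field in the inertial frame), not collinear with $e_3$. Standing assumption: there are positive numbers $v_{max},\Omega_{max}$ such that $|v(t)|\le v_{max}$ and $|\Omega(t)|\le\Omega_{max}$ for all $t\ge 0$. Matrices. Let $$\Delta=\begin{bmatrix} e_1^\top\\ e_2^\top\\ e_3^\top R\end{bmatrix}\in\mathbb{R}^{3\times 3}.$$ For the $\tilde\lambda$ parametrization, $$A^\star=\begin{bmatrix}0_{3\times3}&0_{3\times3}\\ gR^\top[e_3]_\times & -[\Omega]_\times\end{bmatrix},\qquad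 C^\star=\begin{bmatrix}\begin{bmatrix}0_{2\times3}\\ -e_3^\top[v]_\times\end{bmatrix}&\Delta\\ [m_{\mathcal I}]_\times&0_{3\times3}\end{bmatrix}.$$ For the $\bar\lambda$ parametrization, $$A^\star=\begin{bmatrix}-[\Omega]_\times&0_{3\times3}\\ g[R^\top e_3]_\times & -[\Omega]_\times\end{bmatrix},\qquad C^\star=\begin{bmatrix}\begin{bmatrix}0_{2\times3}\\ -e_3^\top[v]_\times R\end{bmatrix}&\Delta\\ [m_{\mathcal I}]_\times R&0_{3\times3}\end{bmatrix}.$$ In both cases $A^\star(t)\in\mathbb{R}^{6\times6}$, $C^\star(t)\in\mathbb{R}^{6\times6}$, and $$M=\begin{bmatrix}C^\star\\ C^\star A^\star+\dot C^\star\end{bmatrix}\in\mathbb{R}^{12\times 6},\qquad D=M^\top M\in\mathbb{R}^{6\times6}.$$ *)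

theory Defs
  imports "HOL-Analysis.Analysis"
begin

abbreviation e1 :: "real^3" where "e1 \<equiv> axis 1 1"
abbreviation e2 :: "real^3" where "e2 \<equiv> axis 2 1"
abbreviation e3 :: "real^3" where "e3 \<equiv> axis 3 1"

definition skew :: "real^3 \<Rightarrow> real^3^3" where
  "skew u = matrix (\<lambda>w. cross3 u w)"

text \<open>Positive semidefinite matrices. The order that \<^typ>\<open>real^'n^'n\<close> inherits from the library
  is componentwise, so \<open>A \<ge> B\<close> in the sense of symmetric matrices is written \<open>psd (A - B)\<close>.\<close>

definition psd :: "real^'n^'n \<Rightarrow> bool" where
  "psd A \<longleftrightarrow> transpose A = A \<and> (\<forall>x. 0 \<le> x \<bullet> (A *v x))"

text \<open>Block matrices are indexed by sum types, \<open>Inl\<close> being the first block of indices. Thus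
  \<open>3 + 3\<close> stands for the index set of 6 elements and \<open>(3 + 3) + (3 + 3)\<close> for that of 12.\<close>

definition stack :: "'a^'n^'m1 \<Rightarrow> 'a^'n^'m2 \<Rightarrow> 'a^'n^('m1 + 'm2)" where
  "stack P Q = (\<chi> i j. case i of Inl a \<Rightarrow> P $ a $ j | Inr a \<Rightarrow> Q $ a $ j)"

definition four_block ::
    "'a^'n1^'m1 \<Rightarrow> 'a^'n2^'m1 \<Rightarrow> 'a^'n1^'m2 \<Rightarrow> 'a^'n2^'m2 \<Rightarrow> 'a^('n1 + 'n2)^('m1 + 'm2)" where
  "four_block P Q S T =
    (\<chi> i j. case i of
       Inl a \<Rightarrow> (case j of Inl b \<Rightarrow> P $ a $ b | Inr b \<Rightarrow> Q $ a $ b)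
     | Inr a \<Rightarrow> (case j of Inl b \<Rightarrow> S $ a $ b | Inr b \<Rightarrow> T $ a $ b))"

text \<open>In \<^term>\<open>vector [x, y, z]\<close> the three vectors are the rows, and \<^term>\<open>x v* P\<close> is the row
  vector \<open>x\<^sup>T P\<close>.\<close>

definition Delta :: "real^3^3 \<Rightarrow> real^3^3" where
  "Delta R = vector [e1, e2, e3 v* R]"

definition A_tilde :: "real \<Rightarrow> real^3^3 \<Rightarrow> real^3 \<Rightarrow> real^(3+3)^(3+3)" where
  "A_tilde g R \<Omega> = four_block 0 0 (g *\<^sub>R (transpose R ** skew e3)) (- skew \<Omega>)"

definition C_tilde :: "real^3 \<Rightarrow> real^3^3 \<Rightarrow> real^3 \<Rightarrow> real^(3+3)^(3+3)" where
  "C_tilde m R v = four_block (vector [0, 0, - (e3 v* skew v)]) (Delta R) (skew m) 0"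

definition A_bar :: "real \<Rightarrow> real^3^3 \<Rightarrow> real^3 \<Rightarrow> real^(3+3)^(3+3)" where
  "A_bar g R \<Omega> = four_block (- skew \<Omega>) 0 (g *\<^sub>R skew (transpose R *v e3)) (- skew \<Omega>)"

definition C_bar :: "real^3 \<Rightarrow> real^3^3 \<Rightarrow> real^3 \<Rightarrow> real^(3+3)^(3+3)" where
  "C_bar m R v = four_block (vector [0, 0, - (e3 v* (skew v ** R))]) (Delta R) (skew m ** R) 0"

text \<open>Trajectories matter only on \<^term>\<open>{0..} :: real set\<close>; the time derivative at 0 is one-sided.\<close>

definition obs_M ::
    "(real \<Rightarrow> real^(3+3)^(3+3)) \<Rightarrow> (real \<Rightarrow> real^(3+3)^(3+3)) \<Rightarrow> real
      \<Rightarrow> real^(3+3)^((3+3)+(3+3))" where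
  "obs_M A C t = stack (C t) (C t ** A t + vector_derivative C (at t within {0..}))"

definition obs_D ::
    "(real \<Rightarrow> real^(3+3)^(3+3)) \<Rightarrow> (real \<Rightarrow> real^(3+3)^(3+3)) \<Rightarrow> real \<Rightarrow> real^(3+3)^(3+3)" where
  "obs_D A C t = transpose (obs_M A C t) ** obs_M A C t"

definition D_tilde ::
    "real \<Rightarrow> real^3 \<Rightarrow> (real \<Rightarrow> real^3^3) \<Rightarrow> (real \<Rightarrow> real^3) \<Rightarrow> (real \<Rightarrow> real^3)
      \<Rightarrow> real \<Rightarrow> real^(3+3)^(3+3)" where
  "D_tilde g m R \<Omega> v = obs_D (\<lambda>t. A_tilde g (R t) (\<Omega> t)) (\<lambda>t. C_tilde m (R t) (v t))"

definition D_bar ::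
    "real \<Rightarrow> real^3 \<Rightarrow> (real \<Rightarrow> real^3^3) \<Rightarrow> (real \<Rightarrow> real^3) \<Rightarrow> (real \<Rightarrow> real^3)
      \<Rightarrow> real \<Rightarrow> real^(3+3)^(3+3)" where
  "D_bar g m R \<Omega> v = obs_D (\<lambda>t. A_bar g (R t) (\<Omega> t)) (\<lambda>t. C_bar m (R t) (v t))"

end

(*
  Write x = (y0, z) and y = T y0, where T is the identity for the first parametrization and T = R
  for the second; put c = m . y, w = e3 x m, q = w . R e3.  The components of F = |M x| used are
  z_1, z_2, e3 . R z - e3 . (v x y), m x y and the first two of g R^T (e3 x y) - Omega x z.
  Up to errors of size F, the first three give |z_3| R_33^2 <= v_max |y|, and the others say that
  R e3 follows a gradient flow of q:
     z_3 (q c^3)' >= g |w|^2 |y|^4 R_33^2.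
  As q c^3 is bounded, integrating the latter over a long window, on which the integral of R_33^2
  grows linearly, forces |y| to be small compared with |z_3|, against the former.  Hence the
  integral of F over a long window dominates |x|, and Cauchy-Schwarz bounds that of F^2.
*)
theory Submission
  imports Defs
begin

text \<open>Why a gradient flow appears: x does not depend on time, so z and |y| are constant along
  a trajectory, and a small m x y leaves y close to c m. The first two components of g R^T (e3 x y)
  - Omega x z then say, up to errors, that z_3 (R e3)' = g c P w, where P projects onto the tangent
  plane of the unit sphere at R e3; and P w is the gradient of q on the sphere. Its squared length
  is |w|^2 - q^2, which vanishes only at w/|w| and -w/|w|. Since w is orthogonal to e3, both points
  are horizontal, that is R_33 = 0 there: persistent excitation of R_33 prevents R e3 from resting
  at an equilibrium, which is what the lower bound |w|^2 R_33^2 records.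

  The obstacle is that F is controlled only in the mean. Every error term is therefore kept linear
  in F, with a coefficient of degree 3 in (|y|, |z_3|) jointly, so that after integration the
  inequality is homogeneous of degree 4 and |y|^3 can be cancelled. Nothing is ever divided by z_3,
  which may vanish.\<close>

section \<open>Norms, orthogonal matrices and cross products\<close>

lemma orthogonal_matrix_vector_dot:
  fixes Q :: "real^'n^'n"
  assumes "orthogonal_matrix Q"
  shows "(Q *v x) \<bullet> (Q *v y) = x \<bullet> y"
proof -
  have "(Q *v x) \<bullet> (Q *v y) = (x v* transpose Q) \<bullet> (Q *v y)"
    by (simp add: vector_transpose_matrix)
  also have "\<dots> = x \<bullet> (transpose Q *v (Q *v y))" by (rule dot_lmul_matrix)
  also have "\<dots> = x \<bullet> y"
    using assms unfolding matrix_vector_mul_assoc orthogonal_matrix by simp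
  finally show ?thesis .
qed

lemma norm_orthogonal_matrix_vector:
  fixes Q :: "real^'n^'n"
  assumes "orthogonal_matrix Q"
  shows "norm (Q *v x) = norm x"
  by (simp add: norm_eq orthogonal_matrix_vector_dot[OF assms])

lemma norm_sqr_3: "(norm (x::real^3))\<^sup>2 = (x$1)\<^sup>2 + (x$2)\<^sup>2 + (x$3)\<^sup>2"
  unfolding power2_norm_eq_inner by (simp add: inner_vec_def sum_3 power2_eq_square)

lemma norm_le_l1_3: "norm (x::real^3) \<le> \<bar>x$1\<bar> + \<bar>x$2\<bar> + \<bar>x$3\<bar>"
  using norm_le_l1_cart[of x] by (simp add: sum_3)

lemma norm_cross3_le: "norm (cross3 x y) \<le> norm x * norm y"
proof -
  have "(norm (cross3 x y))\<^sup>2 \<le> (norm x * norm y)\<^sup>2"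
    using norm_cross_dot[of x y] by (smt (verit) zero_le_power2)
  then show ?thesis by (rule power2_le_imp_le) simp
qed

section \<open>Pointwise inequalities along a trajectory\<close>

text \<open>The contributions of \<open>z$1\<close> and \<open>z$2\<close> to
  \<open>R$3 \<bullet> z\<close> are themselves bounded by \<open>F\<close>, which together with the
  error of the measured row makes \<open>3 * F\<close>. Passing from
  \<open>\<bar>R$3$3\<bar>\<close> to its square is harmless because entries of \<open>R\<close> are
  at most 1, and it produces the integrand of the excitation condition.\<close>

lemma coupling_estimate:
  fixes R :: "real^3^3" and v y z :: "real^3"
  assumes "orthogonal_matrix R" and "norm v \<le> V"
    and "\<bar>z$1\<bar> \<le> F" "\<bar>z$2\<bar> \<le> F"
    and "\<bar>R$3 \<bullet> z - e3 \<bullet> cross3 v y\<bar> \<le> F"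
  shows "\<bar>z$3\<bar> * (R$3$3)\<^sup>2 \<le> 3 * F + V * norm y"
proof -
  have "norm (R$3) = 1"
    using assms(1) by (simp add: orthogonal_matrix_orthonormal_rows row_def vec_nth_inverse)
  then have R: "\<bar>R$3$i\<bar> \<le> 1" for i by (metis component_le_norm_cart)
  have "\<bar>e3 \<bullet> cross3 v y\<bar> \<le> norm (cross3 v y)"
    by (metis component_le_norm_cart inner_axis' inner_real_def mult_1)
  also have "\<dots> \<le> V * norm y"
    by (meson norm_cross3_le assms(2) mult_right_mono norm_ge_zero order_trans)
  finally have cr: "\<bar>e3 \<bullet> cross3 v y\<bar> \<le> V * norm y" .
  have "\<bar>R$3$1 * z$1\<bar> \<le> 1 * F" "\<bar>R$3$2 * z$2\<bar> \<le> 1 * F"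
    unfolding abs_mult by (intro mult_mono R assms; simp)+
  moreover have "R$3 \<bullet> z = R$3$1 * z$1 + R$3$2 * z$2 + R$3$3 * z$3"
    by (simp add: inner_vec_def sum_3)
  ultimately have "\<bar>R$3$3 * z$3\<bar> \<le> 3 * F + V * norm y"
    using cr assms(5) by linarith
  moreover have "(R$3$3)\<^sup>2 \<le> \<bar>R$3$3\<bar>"
    using mult_right_mono[OF R[of 3], of "\<bar>R$3$3\<bar>"] by (simp add: power2_eq_square abs_mult[symmetric])
  then have "\<bar>z$3\<bar> * (R$3$3)\<^sup>2 \<le> \<bar>z$3\<bar> * \<bar>R$3$3\<bar>" by (rule mult_left_mono) simp
  ultimately show ?thesis by (simp add: abs_mult mult.commute)
qed

text \<open>Along a trajectory \<open>c = m \<bullet> y\<close> may change sign and only \<open>c * c'\<close> is small, not \<open>c'\<close>; the weight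
  \<open>c^3\<close> makes the leading term \<open>c^4\<close> nonnegative and lets \<open>c'\<close> enter only through \<open>c\<^sup>2 * c'\<close>.\<close>

lemma drift_estimate:
  fixes R :: "real^3^3" and \<Omega> m y y' z :: "real^3"
  assumes R: "orthogonal_matrix R" and m: "norm m = 1" and g: "g > 0"
    and \<Omega>: "norm \<Omega> \<le> W" and y': "y \<bullet> y' = 0" "norm y' \<le> W * norm y"
    and z: "\<bar>z$1\<bar> \<le> F" "\<bar>z$2\<bar> \<le> F"
    and my: "\<And>i. \<bar>cross3 m y $ i\<bar> \<le> F"
    and u: "\<And>i. i \<noteq> 3 \<Longrightarrow> \<bar>(g *\<^sub>R (transpose R *v cross3 e3 y) - cross3 \<Omega> z) $ i\<bar> \<le> F"
  defines "w \<equiv> cross3 e3 m" and "c \<equiv> m \<bullet> y"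
  defines "q \<equiv> w \<bullet> (R *v e3)" and "q' \<equiv> w \<bullet> (R *v cross3 \<Omega> e3)" and "c' \<equiv> m \<bullet> y'"
  shows "g * (norm w)\<^sup>2 * norm y ^ 4 * (R$3$3)\<^sup>2 \<le>
     z$3 * (q' * c^3 + q * (3 * c\<^sup>2 * c')) + ((2 + 2 * W + 12 * g) * norm y ^ 3 + 9 * W * \<bar>z$3\<bar> * (norm y)\<^sup>2) * F"
proof -
  \<comment> \<open>The part of \<open>y\<close> orthogonal to the unit vector \<open>m\<close>. Its
    length is that of \<open>cross3 m y\<close>, so \<open>y\<close> equals
    \<open>c *\<^sub>R m\<close> up to an error of order \<open>F\<close>.\<close>
  define r where "r = y - c *\<^sub>R m"
  have F0: "F \<ge> 0" using z by linarith
  have W0: "W \<ge> 0" using \<Omega> norm_ge_zero order_trans by blast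
  have mm: "m \<bullet> m = 1" using m by (simp add: norm_eq_1)
  have r2: "(norm r)\<^sup>2 = (norm y)\<^sup>2 - c\<^sup>2"
    unfolding power2_norm_eq_inner r_def c_def
    by (simp add: inner_diff_left inner_diff_right mm inner_commute power2_eq_square)
  have "(norm (cross3 m y))\<^sup>2 = (norm r)\<^sup>2"
    using norm_cross_dot[of m y] by (simp add: r2 c_def m)
  then have "norm r = norm (cross3 m y)" by (metis norm_ge_zero power2_eq_imp_eq)
  then have rF: "norm r \<le> 3 * F"
    using norm_le_l1_3[of "cross3 m y"] my[of 1] my[of 2] my[of 3] by linarith
  have cy: "\<bar>c\<bar> \<le> norm y"
    using Cauchy_Schwarz_ineq2[of m y] by (simp add: c_def m)
  have w1: "norm w \<le> 1" using norm_cross3_le[of e3 m] by (simp add: w_def m)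
  have R': "orthogonal_matrix (transpose R)" using R by simp
  \<comment> \<open>Body coordinates of \<open>w\<close>: the third is \<open>q\<close>, and the
    velocity of \<open>R *v e3\<close> involves only the other two.\<close>
  define p where "p = transpose R *v w"
  have pn: "norm p = norm w" unfolding p_def by (rule norm_orthogonal_matrix_vector[OF R'])
  have p1: "\<bar>p$i\<bar> \<le> 1" for i using component_le_norm_cart[of p i] pn w1 by linarith
  have tr: "w \<bullet> (R *v x) = p \<bullet> x" for x
    by (metis p_def dot_lmul_matrix transpose_matrix_vector transpose_transpose)
  have q: "q = p$3" by (simp add: q_def tr inner_axis)
  have q': "q' = p$1 * \<Omega>$2 - p$2 * \<Omega>$1"
    unfolding q'_def tr by (simp add: cross3_simps axis_def)
  have q1: "\<bar>q\<bar> \<le> 1" using p1 q by simp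
  \<comment> \<open>The squared length of the component of \<open>w\<close> tangent to the sphere at
    \<open>R *v e3\<close>.\<close>
  define s where "s = (p$1)\<^sup>2 + (p$2)\<^sup>2"
  have s: "s = (norm w)\<^sup>2 - q\<^sup>2" using norm_sqr_3[of p] by (simp add: s_def q pn)
  have s1: "s \<le> 1" using s w1 by (smt (verit) norm_ge_zero power_le_one zero_le_power2)
  have col: "(R$1$3)\<^sup>2 + (R$2$3)\<^sup>2 + (R$3$3)\<^sup>2 = 1"
    using norm_orthogonal_matrix_vector[OF R, of e3] norm_sqr_3[of "R *v e3"]
    by (simp add: matrix_vector_mul_component inner_axis)
  have w3: "w$3 = 0" by (simp add: w_def cross3_simps axis_def)
  have qe: "q = w$1 * R$1$3 + w$2 * R$2$3"
    by (simp add: q_def inner_vec_def sum_3 w3 matrix_vector_mul_component axis_def)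
  \<comment> \<open>Cauchy-Schwarz in the horizontal plane: \<open>w\<close> has no vertical
    component, so \<open>q\<close> sees only the horizontal part of \<open>R *v e3\<close>, of
    squared length \<open>1 - (R$3$3)\<^sup>2\<close>.\<close>
  have "q\<^sup>2 \<le> ((w$1)\<^sup>2 + (w$2)\<^sup>2) * ((R$1$3)\<^sup>2 + (R$2$3)\<^sup>2)"
    unfolding qe using zero_le_power2[of "w$1 * R$2$3 - w$2 * R$1$3"]
    by (simp add: power2_eq_square algebra_simps)
  also have "\<dots> = (norm w)\<^sup>2 * (1 - (R$3$3)\<^sup>2)" using norm_sqr_3[of w] w3 col by simp
  finally have sR: "(norm w)\<^sup>2 * (R$3$3)\<^sup>2 \<le> s" by (simp add: s algebra_simps)

  define k where "k = transpose R *v cross3 e3 r"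
  have "norm k \<le> 3 * F"
    using norm_cross3_le[of e3 r] rF unfolding k_def norm_orthogonal_matrix_vector[OF R'] by simp
  then have k: "\<bar>k$i\<bar> \<le> 3 * F" for i using component_le_norm_cart[of k i] by linarith
  have "cross3 e3 y = c *\<^sub>R w + cross3 e3 r"
    by (simp add: r_def w_def Cross3.right_diff_distrib cross_mult_right)
  then have h: "transpose R *v cross3 e3 y = c *\<^sub>R p + k"
    unfolding p_def k_def by (simp only: matrix_vector_right_distrib matrix_vector_mult_scaleR)
  define u1 where "u1 = g * (c * p$1 + k$1) - (\<Omega>$2 * z$3 - \<Omega>$3 * z$2)"
  define u2 where "u2 = g * (c * p$2 + k$2) - (\<Omega>$3 * z$1 - \<Omega>$1 * z$3)"
  have u12: "\<bar>u1\<bar> \<le> F" "\<bar>u2\<bar> \<le> F"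
    using u[of 1] u[of 2] unfolding h by (simp_all add: u1_def u2_def cross_components mult.commute)
  \<comment> \<open>Solving the definitions of \<open>u1\<close> and \<open>u2\<close> for
    \<open>z$3 * \<Omega>$2\<close> and \<open>- z$3 * \<Omega>$1\<close> gives
    \<open>g * c * p$1\<close> and \<open>g * c * p$2\<close> plus remainders; \<open>e\<close>
    collects these remainders after pairing with \<open>p$1\<close> and \<open>p$2\<close>.\<close>
  define e where "e = p$1 * (g * k$1 - u1 + \<Omega>$3 * z$2) + p$2 * (g * k$2 - u2 - \<Omega>$3 * z$1)"
  have zq': "z$3 * q' = g * c * s + e"
    by (simp add: q' s_def e_def u1_def u2_def power2_eq_square algebra_simps)
  have \<Omega>3: "\<bar>\<Omega>$3\<bar> \<le> W" using component_le_norm_cart[of \<Omega> 3] \<Omega> by linarith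
  have oz: "\<bar>\<Omega>$3 * z$i\<bar> \<le> W * F" if "\<bar>z$i\<bar> \<le> F" for i
    unfolding abs_mult using \<Omega>3 that W0 by (intro mult_mono) auto
  have gk: "\<bar>g * k$i\<bar> \<le> g * (3 * F)" for i
    unfolding abs_mult using k g by (simp)
  have b: "\<bar>p$i * x\<bar> \<le> B" if "\<bar>x\<bar> \<le> B" for i x B
    unfolding abs_mult using mult_mono[OF p1 that] by simp
  have err1: "\<bar>g * k$1 - u1 + \<Omega>$3 * z$2\<bar> \<le> g * (3 * F) + F + W * F"
    using gk[of 1] u12 oz[OF z(2)] by linarith
  have err2: "\<bar>g * k$2 - u2 - \<Omega>$3 * z$1\<bar> \<le> g * (3 * F) + F + W * F"
    using gk[of 2] u12 oz[OF z(1)] by linarith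
  have add: "\<bar>x + y\<bar> \<le> 2 * B" if "\<bar>x\<bar> \<le> B" "\<bar>y\<bar> \<le> B" for x y B :: real
    using that by linarith
  have "\<bar>e\<bar> \<le> 2 * (g * (3 * F) + F + W * F)"
    unfolding e_def by (rule add[OF b[OF err1] b[OF err2]])
  then have e: "\<bar>e\<bar> \<le> (2 + 2 * W + 6 * g) * F" by (simp add: algebra_simps)

  have c3: "\<bar>c^3\<bar> \<le> norm y ^ 3" unfolding power_abs using cy by (rule power_mono) simp
  have "\<bar>e * c^3\<bar> \<le> ((2 + 2 * W + 6 * g) * F) * norm y ^ 3"
    unfolding abs_mult using e c3 by (intro mult_mono) (auto simp: F0 W0 g less_imp_le)
  then have t1: "e * c^3 \<ge> - (2 + 2 * W + 6 * g) * norm y ^ 3 * F" by (simp add: algebra_simps abs_le_iff)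

  have c2: "c\<^sup>2 \<le> (norm y)\<^sup>2" using r2 by (smt (verit) zero_le_power2)
  have ry: "norm r \<le> norm y" by (rule power2_le_imp_le) (simp_all add: r2)
  \<comment> \<open>Of the two factors \<open>norm r\<close>, one is bounded by \<open>3 * F\<close>
    and the other by \<open>norm y\<close>, which keeps the error linear in \<open>F\<close>.
    Replacing \<open>c^4\<close> by \<open>norm y ^ 4\<close> in this way contributes
    \<open>6 * g\<close> to the coefficient \<open>12 * g\<close>; the other half comes from
    \<open>e\<close>.\<close>
  have "norm y ^ 4 - c^4 = (norm r)\<^sup>2 * ((norm y)\<^sup>2 + c\<^sup>2)"
    unfolding r2 by (simp add: power2_eq_square power4_eq_xxxx algebra_simps)
  also have "\<dots> = norm r * norm r * ((norm y)\<^sup>2 + c\<^sup>2)" by (simp only: power2_eq_square)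
  also have "\<dots> \<le> norm y * (3 * F) * (2 * (norm y)\<^sup>2)"
    using ry rF c2 by (intro mult_mono) (auto simp: F0)
  finally have d4: "norm y ^ 4 - c^4 \<le> 6 * F * norm y ^ 3" by (simp add: power2_eq_square power3_eq_cube algebra_simps)
  have "0 \<le> norm y ^ 4 - c^4" using c2 power_mono[OF cy, of 4] by simp
  then have "(norm y ^ 4 - c^4) * s \<le> (6 * F * norm y ^ 3) * 1"
    using d4 s1 by (intro mult_mono) (auto simp: F0 s_def)
  moreover have "(norm w)\<^sup>2 * (R$3$3)\<^sup>2 * norm y ^ 4 \<le> s * norm y ^ 4" using sR by (rule mult_right_mono) simp
  ultimately have "(norm w)\<^sup>2 * (R$3$3)\<^sup>2 * norm y ^ 4 \<le> c^4 * s + 6 * F * norm y ^ 3" by (simp add: algebra_simps)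
  from mult_left_mono[OF this, of g]
  have t2: "g * (norm w)\<^sup>2 * norm y ^ 4 * (R$3$3)\<^sup>2 \<le> g * c^4 * s + 6 * g * norm y ^ 3 * F"
    using g by (simp add: algebra_simps)

  \<comment> \<open>As \<open>y'\<close> is orthogonal to \<open>y\<close>, the product
    \<open>c * c'\<close> is carried entirely by the small vector \<open>r\<close>.\<close>
  have cc: "c * c' = - (r \<bullet> y')" using y'(1) by (simp add: r_def c'_def inner_diff_left)
  have "\<bar>r \<bullet> y'\<bar> \<le> norm r * norm y'" by (rule Cauchy_Schwarz_ineq2)
  also have "\<dots> \<le> 3 * F * (W * norm y)" using rF y'(2) by (intro mult_mono) (auto simp: F0)
  finally have cc': "\<bar>c * c'\<bar> \<le> 3 * F * (W * norm y)" by (simp add: cc)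
  have "\<bar>q * c * (c * c')\<bar> \<le> (1 * norm y) * (3 * F * (W * norm y))"
    unfolding abs_mult[of "q * c"] abs_mult[of q c] using cc' q1 cy by (intro mult_mono) (auto simp: F0)
  then have "\<bar>z$3\<bar> * \<bar>q * c * (c * c')\<bar> \<le> \<bar>z$3\<bar> * ((1 * norm y) * (3 * F * (W * norm y)))"
    by (rule mult_left_mono) simp
  then have "\<bar>z$3 * (q * c * (c * c'))\<bar> \<le> \<bar>z$3\<bar> * ((1 * norm y) * (3 * F * (W * norm y)))"
    by (simp only: abs_mult[of "z$3"])
  then have t3: "3 * (z$3 * (q * c * (c * c'))) \<ge> - 9 * W * \<bar>z$3\<bar> * (norm y)\<^sup>2 * F"
    by (simp add: abs_le_iff power2_eq_square algebra_simps)
  have "z$3 * (q' * c^3 + q * (3 * c\<^sup>2 * c')) = (z$3 * q') * c^3 + 3 * (z$3 * (q * c * (c * c')))"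
    by (simp add: power2_eq_square algebra_simps)
  also have "\<dots> = g * c^4 * s + e * c^3 + 3 * (z$3 * (q * c * (c * c')))"
    unfolding zq' by (simp add: power3_eq_cube power4_eq_xxxx algebra_simps)
  finally show ?thesis using t1 t2 t3 by (simp add: algebra_simps)
qed

section \<open>Integration over a window\<close>

text \<open>Nonnegativity of the variance: the square of \<open>f\<close> minus its mean
  \<open>I / d\<close> is expanded and integrated.\<close>

lemma integral_square_ge:
  fixes f :: "real \<Rightarrow> real"
  assumes "continuous_on {a..a + d} f" and "d > 0"
  shows "(integral {a..a + d} f)\<^sup>2 \<le> d * integral {a..a + d} (\<lambda>s. (f s)\<^sup>2)"
proof -
  define I where "I = integral {a..a + d} f"
  have f: "(f has_integral I) {a..a + d}"
    unfolding I_def by (intro integrable_integral integrable_continuous_real assms)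
  have f2: "((\<lambda>s. (f s)\<^sup>2) has_integral integral {a..a + d} (\<lambda>s. (f s)\<^sup>2)) {a..a + d}"
    by (intro integrable_integral integrable_continuous_real continuous_intros assms)
  have c: "((\<lambda>s. (I / d)\<^sup>2) has_integral d * (I / d)\<^sup>2) {a..a + d}"
    using has_integral_const_real[of "(I / d)\<^sup>2" a "a + d"] assms(2) by simp
  have hi: "((\<lambda>s. (f s)\<^sup>2 - 2 * (I / d) * f s + (I / d)\<^sup>2) has_integral
      integral {a..a + d} (\<lambda>s. (f s)\<^sup>2) - 2 * (I / d) * I + d * (I / d)\<^sup>2) {a..a + d}"
    by (intro has_integral_add has_integral_diff has_integral_mult_right f f2 c)
  have nn: "(f s)\<^sup>2 - 2 * (I / d) * f s + (I / d)\<^sup>2 \<ge> 0" for s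
    using zero_le_power2[of "f s - I / d"] by (simp add: power2_diff algebra_simps)
  have "0 \<le> integral {a..a + d} (\<lambda>s. (f s)\<^sup>2) - 2 * (I / d) * I + d * (I / d)\<^sup>2"
    by (rule has_integral_nonneg[OF hi nn])
  also have "\<dots> = integral {a..a + d} (\<lambda>s. (f s)\<^sup>2) - I\<^sup>2 / d"
    using assms(2) by (simp add: field_simps power2_eq_square)
  finally show ?thesis using assms(2) by (simp add: I_def field_simps)
qed

text \<open>Excitation is assumed for a single window length; concatenating windows transfers it to
  arbitrarily long ones with a linearly growing integral.\<close>

lemma integral_windows_ge:
  fixes f :: "real \<Rightarrow> real"
  assumes f: "continuous_on {0..} f" and d: "d > 0"
    and w: "\<And>t. t \<ge> 0 \<Longrightarrow> integral {t..t + d} f \<ge> C" and t: "t \<ge> 0"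
  shows "integral {t..t + real n * d} f \<ge> real n * C"
proof (induction n)
  case (Suc n)
  let ?u = "t + real n * d"
  have tu: "t \<le> ?u" "?u \<le> ?u + d" using d by auto
  have "f integrable_on {t..?u + d}"
    by (intro integrable_continuous_real continuous_on_subset[OF f]) (use t in auto)
  from Henstock_Kurzweil_Integration.integral_combine[OF tu this]
  have "integral {t..?u + d} f = integral {t..?u} f + integral {?u..?u + d} f" by simp
  moreover have "integral {?u..?u + d} f \<ge> C" using w t tu by auto
  ultimately show ?case using Suc by (simp add: algebra_simps)
qed simp

text \<open>Here \<open>\<zeta>\<close>, \<open>Y\<close>, \<open>\<beta>\<close> and
  \<open>G\<close> stand for z_3, |y|, R_33^2 and q c^3. Integrating \<open>P1\<close> bounds
  \<open>\<zeta>\<close> by \<open>I\<close> and \<open>Y\<close>. Integrating \<open>P2\<close>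
  sets a term growing like \<open>\<delta> * Y^4\<close> against the boundary term
  \<open>2 * \<bar>\<zeta>\<bar> * Y^3\<close>, which does not grow with \<open>\<delta>\<close>;
  the assumption \<open>long\<close> says how large \<open>\<delta>\<close> must be for the former
  to win.\<close>

lemma window_estimate:
  fixes F \<beta> G G' :: "real \<Rightarrow> real"
  assumes \<delta>: "\<delta> \<ge> 1" and pos: "\<rho> > 0" "\<kappa> > 0" "V \<ge> 0" "W \<ge> 0" "K \<ge> 0" "Y \<ge> 0"
    and FI: "(F has_integral I) {t..t + \<delta>}" and F0: "\<And>s. s \<in> {t..t + \<delta>} \<Longrightarrow> F s \<ge> 0"
    and BI: "(\<beta> has_integral J) {t..t + \<delta>}" and J: "J \<ge> \<rho>\<^sup>2 * \<delta>"
    and P1: "\<And>s. s \<in> {t..t + \<delta>} \<Longrightarrow> \<bar>\<zeta>\<bar> * \<beta> s \<le> 3 * F s + V * Y"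
    and P2: "\<And>s. s \<in> {t..t + \<delta>} \<Longrightarrow>
      \<kappa> * Y^4 * \<beta> s \<le> \<zeta> * G' s + (K * Y^3 + 9 * W * \<bar>\<zeta>\<bar> * Y\<^sup>2) * F s"
    and G': "\<And>s. s \<in> {t..t + \<delta>} \<Longrightarrow> (G has_real_derivative G' s) (at s within {t..t + \<delta>})"
    and G: "\<And>s. s \<in> {t..t + \<delta>} \<Longrightarrow> \<bar>G s\<bar> \<le> Y^3"
    and long: "\<kappa> * \<rho>\<^sup>2 * \<delta> \<ge> 2 * ((3 + V) / \<rho>\<^sup>2) + 1"
  defines "L \<equiv> 1 + K + 9 * W * ((3 + V) / \<rho>\<^sup>2)"
  shows "Y \<le> L * I" and "\<bar>\<zeta>\<bar> \<le> (3 + V * L) / \<rho>\<^sup>2 * I"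
proof -
  define k where "k = (3 + V) / \<rho>\<^sup>2"
  have r2: "\<rho>\<^sup>2 > 0" using pos by simp
  have I0: "I \<ge> 0" using has_integral_nonneg[OF FI] F0 by blast
  have c: "((\<lambda>s. V * Y) has_integral \<delta> * (V * Y)) {t..t + \<delta>}"
    using has_integral_const_real[of "V * Y" t "t + \<delta>"] \<delta> by simp
  have "\<bar>\<zeta>\<bar> * J \<le> 3 * I + \<delta> * (V * Y)"
    by (rule has_integral_le[OF has_integral_mult_right[OF BI] has_integral_add[OF has_integral_mult_right[OF FI] c]])
       (use P1 in auto)
  moreover have "\<bar>\<zeta>\<bar> * (\<rho>\<^sup>2 * \<delta>) \<le> \<bar>\<zeta>\<bar> * J" by (rule mult_left_mono[OF J]) simp
  \<comment> \<open>Thanks to \<open>\<delta> \<ge> 1\<close>, the whole inequality can be divided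
    by \<open>\<delta>\<close> while \<open>I\<close> stays as it is, so the constants do not depend
    on the window.\<close>
  moreover have "3 * I \<le> \<delta> * (3 * I)" using mult_right_mono[OF \<delta>, of "3 * I"] I0 by simp
  ultimately have "\<delta> * (\<bar>\<zeta>\<bar> * \<rho>\<^sup>2) \<le> \<delta> * (3 * I + V * Y)" by (simp add: algebra_simps)
  then have "\<bar>\<zeta>\<bar> * \<rho>\<^sup>2 \<le> 3 * I + V * Y" using \<delta> by simp
  then have z: "\<bar>\<zeta>\<bar> \<le> (3 * I + V * Y) / \<rho>\<^sup>2" using r2 by (simp add: field_simps)
  have K3: "9 * W * k \<ge> 0" unfolding k_def using pos r2 by (intro mult_nonneg_nonneg divide_nonneg_nonneg) auto
  have Lk: "L = 1 + K + 9 * W * k" by (simp add: L_def k_def)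
  have L1: "L \<ge> 1" using K3 pos by (simp add: L_def k_def)
  show YL: "Y \<le> L * I"
  \<comment> \<open>The first case is immediate from \<open>L \<ge> 1\<close>. In the second,
    \<open>I < Y\<close> turns the bound on \<open>\<zeta>\<close> into
    \<open>\<bar>\<zeta>\<bar> \<le> k * Y\<close>, and the boundary term becomes a multiple of
    \<open>Y^4\<close>.\<close>
  proof (cases "Y \<le> I")
    case True
    then show ?thesis using mult_right_mono[OF L1 I0] by simp
  next
    case False
    then have Y: "Y > 0" "I \<le> Y" using I0 by auto
    have "(3 * I + V * Y) / \<rho>\<^sup>2 \<le> (3 * Y + V * Y) / \<rho>\<^sup>2" using Y r2 by (intro divide_right_mono) auto
    then have zY: "\<bar>\<zeta>\<bar> \<le> k * Y" using z by (simp add: k_def algebra_simps)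
    have "(G' has_integral G (t + \<delta>) - G t) {t..t + \<delta>}"
      by (rule fundamental_theorem_of_calculus)
         (use \<delta> G' in \<open>auto simp: has_real_derivative_iff_has_vector_derivative\<close>)
    then have "\<kappa> * Y^4 * J \<le> \<zeta> * (G (t + \<delta>) - G t) + (K * Y^3 + 9 * W * \<bar>\<zeta>\<bar> * Y\<^sup>2) * I"
      by (intro has_integral_le[OF has_integral_mult_right[OF BI] has_integral_add[OF has_integral_mult_right has_integral_mult_right[OF FI]]])
         (use P2 in auto)
    moreover have "\<kappa> * Y^4 * (\<rho>\<^sup>2 * \<delta>) \<le> \<kappa> * Y^4 * J" using J pos by (intro mult_left_mono) auto
    moreover have "\<zeta> * (G (t + \<delta>) - G t) \<le> \<bar>\<zeta>\<bar> * (2 * Y^3)"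
    proof -
      have "\<bar>G (t + \<delta>) - G t\<bar> \<le> 2 * Y^3" using G[of t] G[of "t + \<delta>"] \<delta> by auto
      then have "\<bar>\<zeta> * (G (t + \<delta>) - G t)\<bar> \<le> \<bar>\<zeta>\<bar> * (2 * Y^3)" unfolding abs_mult by (rule mult_left_mono) simp
      then show ?thesis by simp
    qed
    moreover have "\<bar>\<zeta>\<bar> * (2 * Y^3) \<le> k * Y * (2 * Y^3)"
      using zY Y by (intro mult_right_mono) auto
    moreover have "9 * W * \<bar>\<zeta>\<bar> * Y\<^sup>2 * I \<le> 9 * W * (k * Y) * Y\<^sup>2 * I"
      using zY pos I0 by (intro mult_right_mono mult_left_mono) auto
    \<comment> \<open>The boundary term is at most \<open>2 * k * Y^4\<close>; the extra 1 leaves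
      one \<open>Y^4\<close> on the left, hence a single \<open>Y\<close> once \<open>Y^3\<close> is
      cancelled.\<close>
    moreover have "(2 * k + 1) * Y^4 \<le> \<kappa> * \<rho>\<^sup>2 * \<delta> * Y^4"
      using long unfolding k_def[symmetric] by (rule mult_right_mono) simp
    ultimately have "(2 * k + 1) * Y^4 \<le> k * Y * (2 * Y^3) + K * Y^3 * I + 9 * W * (k * Y) * Y\<^sup>2 * I"
      unfolding distrib_right[of "K * Y^3"] mult.assoc[of \<kappa>] by (simp add: mult.commute mult.left_commute)
    moreover have "(2 * k + 1) * Y^4 = Y^3 * ((2 * k + 1) * Y)"
      by (simp add: power4_eq_xxxx power3_eq_cube)
    moreover have "k * Y * (2 * Y^3) + K * Y^3 * I + 9 * W * (k * Y) * Y\<^sup>2 * I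
      = Y^3 * (k * (2 * Y) + K * I + 9 * W * k * I)"
      by (simp add: distrib_left power2_eq_square power3_eq_cube)
    ultimately have "Y^3 * ((2 * k + 1) * Y) \<le> Y^3 * (k * (2 * Y) + K * I + 9 * W * k * I)"
      by (simp only:)
    then have "(2 * k + 1) * Y \<le> k * (2 * Y) + K * I + 9 * W * k * I"
      by (rule mult_left_le_imp_le) (use Y in simp)
    then have "Y \<le> K * I + 9 * W * k * I" by (simp add: algebra_simps)
    then show ?thesis using I0 by (simp add: Lk algebra_simps)
  qed
  have "(3 * I + V * Y) / \<rho>\<^sup>2 \<le> (3 * I + V * (L * I)) / \<rho>\<^sup>2"
    using YL pos r2 by (intro divide_right_mono add_left_mono mult_left_mono) auto
  then show "\<bar>\<zeta>\<bar> \<le> (3 + V * L) / \<rho>\<^sup>2 * I" using z by (simp add: algebra_simps)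
qed

section \<open>Block vectors and integrals of Gram matrices\<close>

definition lft :: "'a^('m::finite + 'n::finite) \<Rightarrow> 'a^'m" where "lft x = (\<chi> i. x $ Inl i)"
definition rgt :: "'a^('m::finite + 'n::finite) \<Rightarrow> 'a^'n" where "rgt x = (\<chi> i. x $ Inr i)"

lemma sum_UNIV_Plus:
  fixes f :: "'m::finite + 'n::finite \<Rightarrow> 'a::comm_monoid_add"
  shows "sum f UNIV = (\<Sum>i\<in>UNIV. f (Inl i)) + (\<Sum>i\<in>UNIV. f (Inr i))"
proof -
  have "sum f UNIV = sum f (UNIV <+> UNIV)" by (simp only: UNIV_Plus_UNIV)
  also have "\<dots> = sum (f \<circ> Inl) UNIV + sum (f \<circ> Inr) UNIV"
    by (rule sum.Plus) (rule finite)+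
  also have "\<dots> = (\<Sum>i\<in>UNIV. f (Inl i)) + (\<Sum>i\<in>UNIV. f (Inr i))"
    by (simp only: o_def)
  finally show ?thesis .
qed

lemma norm_le_lft_rgt:
  fixes x :: "real^('m::finite + 'n::finite)"
  shows "norm x \<le> norm (lft x) + norm (rgt x)"
proof (rule power2_le_imp_le)
  have "(norm x)\<^sup>2 = (norm (lft x))\<^sup>2 + (norm (rgt x))\<^sup>2"
    unfolding power2_norm_eq_inner inner_vec_def lft_def rgt_def vec_lambda_beta
    by (rule sum_UNIV_Plus)
  also have "\<dots> \<le> (norm (lft x) + norm (rgt x))\<^sup>2" by (simp add: power2_sum)
  finally show "(norm x)\<^sup>2 \<le> (norm (lft x) + norm (rgt x))\<^sup>2" .
qed simp

lemma continuous_on_matrix_mult: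
  fixes A :: "'a::topological_space \<Rightarrow> real^'n^'m"
  assumes "continuous_on S A" "continuous_on S B"
  shows "continuous_on S (\<lambda>s. A s ** B s)"
  unfolding matrix_matrix_mult_def
  by (intro continuous_on_vec_lambda continuous_on_sum continuous_on_mult continuous_on_component assms)

lemma continuous_on_matrix_vector_mult:
  fixes A :: "'a::topological_space \<Rightarrow> real^'n^'m"
  assumes "continuous_on S A"
  shows "continuous_on S (\<lambda>s. A s *v x)"
  unfolding matrix_vector_mult_def
  by (intro continuous_on_vec_lambda continuous_on_sum continuous_on_mult continuous_on_component continuous_on_const assms)

lemma continuous_on_transpose:
  fixes A :: "'a::topological_space \<Rightarrow> real^'n^'m"
  assumes "continuous_on S A"
  shows "continuous_on S (\<lambda>s. transpose (A s))"
  unfolding transpose_def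
  by (intro continuous_on_vec_lambda continuous_on_component assms)

text \<open>Transposition and \<open>\<lambda>A. x \<bullet> (A *v x)\<close> are linear, so they
  commute with the integral. Symmetry is thus inherited from the integrand, and the quadratic form
  becomes the integral of the squared output norm.\<close>

lemma psd_integral_gram:
  fixes M :: "real \<Rightarrow> real^'n^'k" and D :: "real \<Rightarrow> real^'n^'n"
  assumes M: "continuous_on {a..b} M" and D: "\<And>s. s \<in> {a..b} \<Longrightarrow> D s = transpose (M s) ** M s"
    and le: "\<And>x. \<mu> * (norm x)\<^sup>2 \<le> c * integral {a..b} (\<lambda>s. (norm (M s *v x))\<^sup>2)"
  shows "psd (c *\<^sub>R integral {a..b} D - \<mu> *\<^sub>R mat 1)"
proof -
  have "continuous_on {a..b} (\<lambda>s. transpose (M s) ** M s)"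
    by (intro continuous_on_matrix_mult continuous_on_transpose M)
  then have "(\<lambda>s. transpose (M s) ** M s) integrable_on {a..b}" by (rule integrable_continuous_real)
  then have int: "D integrable_on {a..b}" by (rule integrable_eq) (simp add: D)
  let ?E = "integral {a..b} D"
  have lin: "(\<lambda>s. h (D s)) integrable_on {a..b} \<and> h ?E = integral {a..b} (\<lambda>s. h (D s))"
    if "linear h" for h :: "real^'n^'n \<Rightarrow> 'c::euclidean_space"
    using integral_linear[OF int, of h] integrable_linear[OF int, of h] that
    by (simp add: o_def linear_conv_bounded_linear)
  have "linear (transpose :: real^'n^'n \<Rightarrow> _)"
    by (intro linearI) (simp_all add: transpose_def vec_eq_iff)
  with lin have "transpose ?E = integral {a..b} (\<lambda>s. transpose (D s))" by blast
  also have "\<dots> = ?E"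
    by (intro integral_cong) (simp add: D matrix_transpose_mul)
  finally have sym: "transpose ?E = ?E" .
  have quad: "x \<bullet> (?E *v x) = integral {a..b} (\<lambda>s. (norm (M s *v x))\<^sup>2)" for x
  proof -
    have "linear (\<lambda>A :: real^'n^'n. x \<bullet> (A *v x))"
      by (intro linearI) (simp_all add: matrix_vector_mult_add_rdistrib inner_add_right scaleR_matrix_vector_assoc[symmetric])
    with lin have "x \<bullet> (?E *v x) = integral {a..b} (\<lambda>s. x \<bullet> (D s *v x))" by blast
    also have "\<dots> = integral {a..b} (\<lambda>s. (norm (M s *v x))\<^sup>2)"
    proof (intro integral_cong)
      fix s assume "s \<in> {a..b}"
      then have "x \<bullet> (D s *v x) = x \<bullet> (transpose (M s) *v (M s *v x))"
        by (simp add: D matrix_vector_mul_assoc del: transpose_matrix_vector)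
      also have "\<dots> = (norm (M s *v x))\<^sup>2"
        by (metis dot_lmul_matrix power2_norm_eq_inner vector_transpose_matrix transpose_transpose)
      finally show "x \<bullet> (D s *v x) = (norm (M s *v x))\<^sup>2" .
    qed
    finally show ?thesis .
  qed
  show ?thesis
    unfolding psd_def
  proof (intro conjI allI)
    have "transpose ?E $ i $ j = ?E $ i $ j" for i j by (simp add: sym)
    then show "transpose (c *\<^sub>R ?E - \<mu> *\<^sub>R mat 1) = c *\<^sub>R ?E - \<mu> *\<^sub>R mat 1"
      by (auto simp: vec_eq_iff transpose_def mat_def)
    fix x
    have "x \<bullet> ((c *\<^sub>R ?E - \<mu> *\<^sub>R mat 1) *v x) = c * (x \<bullet> (?E *v x)) - \<mu> * (x \<bullet> x)"
      by (simp add: matrix_vector_mult_diff_rdistrib inner_diff_right scaleR_matrix_vector_assoc[symmetric])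
    then show "0 \<le> x \<bullet> ((c *\<^sub>R ?E - \<mu> *\<^sub>R mat 1) *v x)"
      using le[of x] by (simp add: quad power2_norm_eq_inner)
  qed
qed

section \<open>The estimate common to both parametrizations\<close>

lemma skew_mult: "skew u *v x = cross3 u x"
  unfolding vec_eq_iff forall_3 skew_def matrix_def matrix_vector_mult_def sum_3
  by (simp add: cross_components axis_def)

text \<open>Orthogonality of \<open>T\<close> gives \<open>y = T *v lft x\<close> a constant length
  and a derivative orthogonal to it, whatever the angular velocity \<open>\<omega>\<close>. The
  matrix \<open>M\<close> is described by the components of \<open>M t *v x\<close> in terms of
  \<open>y\<close> and \<open>rgt x\<close>, a form in which the two parametrizations look
  alike.\<close>

lemma uniform_observability:
  fixes R T :: "real \<Rightarrow> real^3^3" and \<Omega> \<omega> v :: "real \<Rightarrow> real^3" and m :: "real^3"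
    and M :: "real \<Rightarrow> real^(3+3)^((3+3)+(3+3))"
  assumes g: "g > 0" and m: "norm m = 1" "\<not> collinear {0, m, e3}"
    and R: "\<And>t. t \<ge> 0 \<Longrightarrow> orthogonal_matrix (R t)"
    and R': "\<And>t. t \<ge> 0 \<Longrightarrow> (R has_vector_derivative (R t ** skew (\<Omega> t))) (at t within {0..})"
    and T: "\<And>t. t \<ge> 0 \<Longrightarrow> orthogonal_matrix (T t)"
    and T': "\<And>t. t \<ge> 0 \<Longrightarrow> (T has_vector_derivative (T t ** skew (\<omega> t))) (at t within {0..})"
    and V: "\<And>t. t \<ge> 0 \<Longrightarrow> norm (v t) \<le> V"
    and W: "\<And>t. t \<ge> 0 \<Longrightarrow> norm (\<Omega> t) \<le> W" "\<And>t. t \<ge> 0 \<Longrightarrow> norm (\<omega> t) \<le> W"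
    and \<rho>: "\<delta>0 > 0" "\<rho> > 0" "\<And>t. t \<ge> 0 \<Longrightarrow> (1 / \<delta>0) * integral {t..t + \<delta>0} (\<lambda>s. (R s $ 3 $ 3)\<^sup>2) \<ge> \<rho>\<^sup>2"
    and contM: "continuous_on {0..} M"
    and M12: "\<And>t x i. t \<ge> 0 \<Longrightarrow> i \<noteq> 3 \<Longrightarrow> (M t *v x) $ Inl (Inl i) = rgt x $ i"
    and M3: "\<And>t x. t \<ge> 0 \<Longrightarrow>
      (M t *v x) $ Inl (Inl 3) = R t $ 3 \<bullet> rgt x - e3 \<bullet> cross3 (v t) (T t *v lft x)"
    and M46: "\<And>t x i. t \<ge> 0 \<Longrightarrow> (M t *v x) $ Inl (Inr i) = cross3 m (T t *v lft x) $ i"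
    and M78: "\<And>t x i. t \<ge> 0 \<Longrightarrow> i \<noteq> 3 \<Longrightarrow> (M t *v x) $ Inr (Inl i) =
      (g *\<^sub>R (transpose (R t) *v cross3 e3 (T t *v lft x)) - cross3 (\<Omega> t) (rgt x)) $ i"
  shows "\<exists>\<delta>>0. \<exists>\<mu>>0. \<forall>t\<ge>0. \<forall>x.
    \<mu> * (norm x)\<^sup>2 \<le> (1 / \<delta>) * integral {t..t + \<delta>} (\<lambda>s. (norm (M s *v x))\<^sup>2)"
proof -
  define w where "w = cross3 e3 m"
  \<comment> \<open>Non-collinearity of \<open>m\<close> and \<open>e3\<close> makes the coefficient
    of the drift strictly positive.\<close>
  have "w \<noteq> 0" using m(2) cross_skew[of e3 m] unfolding w_def by (simp add: cross_eq_0[symmetric])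
  then have \<kappa>: "g * (norm w)\<^sup>2 > 0" using g by simp
  have V0: "V \<ge> 0" using V[of 0] norm_ge_zero[of "v 0"] by linarith
  have W0: "W \<ge> 0" using W(1)[of 0] norm_ge_zero[of "\<Omega> 0"] by linarith
  have w1: "norm w \<le> 1" using norm_cross3_le[of e3 m] by (simp add: w_def m)
  \<comment> \<open>The two entries are the requirements \<open>\<delta> \<ge> 1\<close> and
    \<open>long\<close> of \<open>window_estimate\<close>, the latter solved for
    \<open>\<delta>\<close>. The window is then a multiple of \<open>\<delta>0\<close>, so that the
    excitation windows tile it.\<close>
  define B where "B = max 1 ((2 * ((3 + V) / \<rho>\<^sup>2) + 1) / (g * (norm w)\<^sup>2 * \<rho>\<^sup>2))"
  obtain n where n: "B < real n * \<delta>0" using reals_Archimedean3[OF \<rho>(1)] by blast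
  define \<delta> where "\<delta> = real n * \<delta>0"
  have \<delta>: "\<delta> \<ge> 1" using n by (simp add: \<delta>_def B_def)
  have le: "(2 * ((3 + V) / \<rho>\<^sup>2) + 1) / (g * (norm w)\<^sup>2 * \<rho>\<^sup>2) \<le> \<delta>" using n by (simp add: \<delta>_def B_def)
  have bpos: "g * (norm w)\<^sup>2 * \<rho>\<^sup>2 > 0" using \<kappa> \<rho>(2) by simp
  have long: "g * (norm w)\<^sup>2 * \<rho>\<^sup>2 * \<delta> \<ge> 2 * ((3 + V) / \<rho>\<^sup>2) + 1"
    unfolding mult.commute[of "g * (norm w)\<^sup>2 * \<rho>\<^sup>2"]
    by (rule pos_divide_le_eq[THEN iffD1, OF bpos le])
  define K where "K = 2 + 2 * W + 12 * g"
  have K: "K \<ge> 0" using g W0 by (simp add: K_def)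
  define L where "L = 1 + K + 9 * W * ((3 + V) / \<rho>\<^sup>2)"
  have L: "L \<ge> 0" using K V0 W0 by (simp add: L_def)
  \<comment> \<open>The summands bound |y|, then |z_1| and |z_2| together, then |z_3|, each as a
    multiple of the integral of the output norm.\<close>
  define H where "H = L + 2 + (3 + V * L) / \<rho>\<^sup>2"
  have H: "H > 0" using L V0 by (simp add: H_def add_pos_nonneg)
  have contR: "continuous_on {0..} R"
    using R' by (intro continuous_on_vector_derivative) auto
  have cont33: "continuous_on {0..} (\<lambda>s. (R s $ 3 $ 3)\<^sup>2)" by (intro continuous_on_power continuous_on_component contR)
  have main: "norm x \<le> H * integral {t..t + \<delta>} (\<lambda>s. norm (M s *v x))" if t: "t \<ge> 0" for t x
  proof -
    have sub: "{t..t + \<delta>} \<subseteq> {0..}" using t by auto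
    define F where "F s = norm (M s *v x)" for s
    define I where "I = integral {t..t + \<delta>} F"
    define y where "y s = T s *v lft x" for s
    define Y where "Y = norm (lft x)"
    define z where "z = rgt x"
    have cmp: "\<bar>(M s *v x) $ i\<bar> \<le> F s" for s i unfolding F_def by (rule component_le_norm_cart)
    have "continuous_on {t..t + \<delta>} (\<lambda>s. M s *v x)"
      by (intro continuous_on_matrix_vector_mult continuous_on_subset[OF contM sub])
    then have contF: "continuous_on {t..t + \<delta>} F" unfolding F_def by (rule continuous_on_norm)
    have FI: "(F has_integral I) {t..t + \<delta>}"
      unfolding I_def by (intro integrable_integral integrable_continuous_real contF)
    have z: "\<bar>z $ i\<bar> \<le> F s" if "s \<ge> 0" "i \<noteq> 3" for s i using cmp[of s "Inl (Inl i)"] M12[OF that] by (simp add: z_def)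
    have zI: "\<bar>z $ i\<bar> \<le> I" if "i \<noteq> 3" for i
    proof -
      have "((\<lambda>s. \<bar>z $ i\<bar>) has_integral \<delta> * \<bar>z $ i\<bar>) {t..t + \<delta>}"
        using has_integral_const_real[of "\<bar>z $ i\<bar>" t "t + \<delta>"] \<delta> by simp
      then have "\<delta> * \<bar>z $ i\<bar> \<le> I" by (rule has_integral_le[OF _ FI]) (use z that t in auto)
      then show ?thesis using mult_right_mono[OF \<delta>, of "\<bar>z $ i\<bar>"] by simp
    qed
    have ny: "norm (y s) = Y" if "s \<ge> 0" for s
      using norm_orthogonal_matrix_vector[OF T[OF that]] by (simp add: y_def Y_def)
    define y' where "y' s = T s *v cross3 (\<omega> s) (lft x)" for s
    have blin: "bounded_linear (\<lambda>A :: real^3^3. A *v a)" for a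
      by (auto simp: linear_conv_bounded_linear[symmetric] linear_iff matrix_vector_mult_add_rdistrib scaleR_matrix_vector_assoc[symmetric])
    have dy: "(y has_vector_derivative y' s) (at s within {0..})" if "s \<ge> 0" for s
      using bounded_linear.has_vector_derivative[OF blin T'[OF that], of "lft x"]
      by (simp add: y_def[abs_def] y'_def matrix_vector_mul_assoc[symmetric] skew_mult)
    have yy': "y s \<bullet> y' s = 0" "norm (y' s) \<le> W * norm (y s)" if "s \<ge> 0" for s
    proof -
      show "y s \<bullet> y' s = 0"
        unfolding y_def y'_def orthogonal_matrix_vector_dot[OF T[OF that]] by (rule dot_cross_self)
      have "norm (y' s) = norm (cross3 (\<omega> s) (lft x))"
        unfolding y'_def by (rule norm_orthogonal_matrix_vector[OF T[OF that]])
      also have "\<dots> \<le> norm (\<omega> s) * norm (lft x)" by (rule norm_cross3_le)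
      also have "\<dots> \<le> W * norm (y s)" unfolding ny[OF that] Y_def using W(2)[OF that] by (rule mult_right_mono) simp
      finally show "norm (y' s) \<le> W * norm (y s)" .
    qed
    define c where "c s = m \<bullet> y s" for s
    define q where "q s = w \<bullet> (R s *v e3)" for s
    define G where "G s = q s * c s ^ 3" for s
    define G' where "G' s = w \<bullet> (R s *v cross3 (\<Omega> s) e3) * c s ^ 3 + q s * (3 * (c s)\<^sup>2 * (m \<bullet> y' s))" for s
    have dc: "(c has_real_derivative m \<bullet> y' s) (at s within {0..})" if "s \<ge> 0" for s
      using bounded_linear.has_vector_derivative[OF bounded_linear_inner_right dy[OF that], of m]
      by (simp add: c_def[abs_def] has_real_derivative_iff_has_vector_derivative)
    have dq: "(q has_real_derivative w \<bullet> (R s *v cross3 (\<Omega> s) e3)) (at s within {0..})" if "s \<ge> 0" for s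
      using bounded_linear.has_vector_derivative[OF bounded_linear_inner_right
          bounded_linear.has_vector_derivative[OF blin R'[OF that], of e3], of w]
      by (simp add: q_def[abs_def] has_real_derivative_iff_has_vector_derivative matrix_vector_mul_assoc[symmetric] skew_mult)
    have dG: "(G has_real_derivative G' s) (at s within {t..t + \<delta>})" if "s \<in> {t..t + \<delta>}" for s
    proof -
      have s: "s \<ge> 0" using that t by simp
      have "(G has_real_derivative G' s) (at s within {0..})"
        unfolding G_def[abs_def] G'_def
        by (rule derivative_eq_intros dc[OF s] dq[OF s] refl)+ (simp add: algebra_simps)
      then show ?thesis by (rule DERIV_subset) (rule sub)
    qed
    have bG: "\<bar>G s\<bar> \<le> Y^3" if "s \<ge> 0" for s
    proof -
      have "\<bar>q s\<bar> \<le> norm w * norm (R s *v e3)" unfolding q_def by (rule Cauchy_Schwarz_ineq2)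
      then have q: "\<bar>q s\<bar> \<le> 1" using w1 by (simp add: norm_orthogonal_matrix_vector[OF R[OF that]])
      have "\<bar>c s\<bar> \<le> Y" using Cauchy_Schwarz_ineq2[of m "y s"] by (simp add: c_def m ny[OF that])
      then have "\<bar>c s\<bar> ^ 3 \<le> Y ^ 3" by (rule power_mono) simp
      then show ?thesis using mult_mono[OF q, of "\<bar>c s\<bar> ^ 3" "Y ^ 3"] by (simp add: G_def abs_mult power_abs)
    qed
    have BI: "((\<lambda>s. (R s $ 3 $ 3)\<^sup>2) has_integral integral {t..t + \<delta>} (\<lambda>s. (R s $ 3 $ 3)\<^sup>2)) {t..t + \<delta>}"
      by (intro integrable_integral integrable_continuous_real continuous_on_subset[OF cont33 sub])
    have "integral {t..t + \<delta>0} (\<lambda>s. (R s $ 3 $ 3)\<^sup>2) \<ge> \<rho>\<^sup>2 * \<delta>0" if "t \<ge> 0" for t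
      using \<rho>(3)[OF that] \<rho>(1) by (simp add: field_simps)
    from integral_windows_ge[OF cont33 \<rho>(1) this t, of n]
    have J: "integral {t..t + \<delta>} (\<lambda>s. (R s $ 3 $ 3)\<^sup>2) \<ge> \<rho>\<^sup>2 * \<delta>"
      by (simp add: \<delta>_def mult_ac)
    have P1: "\<bar>z$3\<bar> * (R s $ 3 $ 3)\<^sup>2 \<le> 3 * F s + V * Y" if "s \<in> {t..t + \<delta>}" for s
    proof -
      have s: "s \<ge> 0" using that t by simp
      have "\<bar>R s $ 3 \<bullet> z - e3 \<bullet> cross3 (v s) (y s)\<bar> \<le> F s"
        using cmp[of s "Inl (Inl 3)"] unfolding M3[OF s] z_def y_def .
      from coupling_estimate[OF R[OF s] V[OF s] z[OF s] z[OF s] this] show ?thesis by (simp add: ny[OF s])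
    qed
    have P2: "g * (norm w)\<^sup>2 * Y^4 * (R s $ 3 $ 3)\<^sup>2 \<le> z$3 * G' s + (K * Y^3 + 9 * W * \<bar>z$3\<bar> * Y\<^sup>2) * F s"
      if "s \<in> {t..t + \<delta>}" for s
    proof -
      have s: "s \<ge> 0" using that t by simp
      have my: "\<bar>cross3 m (y s) $ i\<bar> \<le> F s" for i using cmp[of s "Inl (Inr i)"] unfolding M46[OF s] y_def .
      have u: "\<bar>(g *\<^sub>R (transpose (R s) *v cross3 e3 (y s)) - cross3 (\<Omega> s) z) $ i\<bar> \<le> F s" if "i \<noteq> 3" for i
        using cmp[of s "Inr (Inl i)"] unfolding M78[OF s that] y_def z_def .
      have z12: "\<bar>z$1\<bar> \<le> F s" "\<bar>z$2\<bar> \<le> F s" by (rule z[OF s]; simp)+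
      from drift_estimate[OF R[OF s] m(1) g W(1)[OF s] yy'[OF s] z12 my u]
      show ?thesis unfolding ny[OF s] G'_def q_def c_def w_def K_def .
    qed
    have est: "Y \<le> L * I" "\<bar>z$3\<bar> \<le> (3 + V * L) / \<rho>\<^sup>2 * I"
      unfolding L_def
      by (rule window_estimate[OF \<delta> \<rho>(2) \<kappa> V0 W0 K _ FI _ BI J P1 P2 dG bG long];
          use t in \<open>simp add: Y_def F_def\<close>)+
    have "norm x \<le> Y + norm z" unfolding Y_def z_def by (rule norm_le_lft_rgt)
    also have "\<dots> \<le> L * I + (I + I + (3 + V * L) / \<rho>\<^sup>2 * I)"
      using norm_le_l1_3[of z] zI[of 1] zI[of 2] est by simp
    also have "\<dots> = H * I" by (simp add: H_def algebra_simps)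
    finally show ?thesis unfolding I_def F_def .
  qed
  \<comment> \<open>Squaring \<open>main\<close> gives \<open>H\<^sup>2\<close>, Cauchy-Schwarz a
    factor \<open>\<delta>\<close>, and averaging another \<open>\<delta>\<close>.\<close>
  have "(1 / (H * \<delta>))\<^sup>2 * (norm x)\<^sup>2 \<le> (1 / \<delta>) * integral {t..t + \<delta>} (\<lambda>s. (norm (M s *v x))\<^sup>2)" if t: "t \<ge> 0" for t x
  proof -
    have sub: "{t..t + \<delta>} \<subseteq> {0..}" using t by auto
    have cont: "continuous_on {t..t + \<delta>} (\<lambda>s. norm (M s *v x))"
      by (intro continuous_on_norm continuous_on_matrix_vector_mult continuous_on_subset[OF contM sub])
    have "(norm x)\<^sup>2 \<le> (H * integral {t..t + \<delta>} (\<lambda>s. norm (M s *v x)))\<^sup>2"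
      by (rule power_mono[OF main[OF t]]) simp
    also have "\<dots> \<le> H\<^sup>2 * (\<delta> * integral {t..t + \<delta>} (\<lambda>s. (norm (M s *v x))\<^sup>2))"
      unfolding power_mult_distrib using integral_square_ge[OF cont] \<delta> by (intro mult_left_mono) auto
    finally show ?thesis using H \<delta> by (simp add: field_simps power2_eq_square)
  qed
  moreover have "(1 / (H * \<delta>))\<^sup>2 > 0" using H \<delta> by simp
  ultimately show ?thesis using \<delta> by (intro exI[of _ \<delta>]) (auto intro: exI[of _ "(1 / (H * \<delta>))\<^sup>2"])
qed

section \<open>Calculus and algebra of block matrices\<close>

text \<open>Conversely, \<open>f\<close> is the finite sum of its components placed along the axes,
  each placement being bounded linear. Used twice in a row, this reduces a matrix derivative to its
  entries.\<close>

lemma has_vector_derivative_vec_iff: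
  fixes f :: "real \<Rightarrow> 'b::euclidean_space^'m"
  shows "(f has_vector_derivative f') F \<longleftrightarrow> (\<forall>i. ((\<lambda>t. f t $ i) has_vector_derivative f' $ i) F)"
proof
  assume "(f has_vector_derivative f') F"
  then show "\<forall>i. ((\<lambda>t. f t $ i) has_vector_derivative f' $ i) F"
    by (intro allI bounded_linear.has_vector_derivative[OF bounded_linear_vec_nth])
next
  assume *: "\<forall>i. ((\<lambda>t. f t $ i) has_vector_derivative f' $ i) F"
  have b: "bounded_linear (\<lambda>a :: 'b. axis i a :: 'b^'m)" for i
    by (auto simp: linear_conv_bounded_linear[symmetric] linear_iff axis_def vec_eq_iff)
  have e: "(\<Sum>i\<in>UNIV. axis i (a $ i)) = a" for a :: "'b^'m"
    by (simp add: vec_eq_iff axis_def)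
  have "((\<lambda>t. \<Sum>i\<in>UNIV. axis i (f t $ i)) has_vector_derivative (\<Sum>i\<in>UNIV. axis i (f' $ i))) F"
    by (rule has_vector_derivative_sum)
       (rule bounded_linear.has_vector_derivative[OF b *[rule_format]])
  then show "(f has_vector_derivative f') F" by (simp add: e)
qed

lemma has_vector_derivative_four_block:
  fixes P :: "real \<Rightarrow> real^'n1^'m1" and Q :: "real \<Rightarrow> real^'n2^'m1"
    and S :: "real \<Rightarrow> real^'n1^'m2" and T :: "real \<Rightarrow> real^'n2^'m2"
  assumes "(P has_vector_derivative P') F" "(Q has_vector_derivative Q') F"
    "(S has_vector_derivative S') F" "(T has_vector_derivative T') F"
  shows "((\<lambda>t. four_block (P t) (Q t) (S t) (T t)) has_vector_derivative four_block P' Q' S' T') F"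
  unfolding has_vector_derivative_vec_iff
proof (intro allI)
  fix i j
  show "((\<lambda>t. four_block (P t) (Q t) (S t) (T t) $ i $ j) has_vector_derivative four_block P' Q' S' T' $ i $ j) F"
    using assms unfolding has_vector_derivative_vec_iff
    by (cases i; cases j) (simp_all add: four_block_def)
qed

lemma has_vector_derivative_rows_3:
  fixes a b c :: "real \<Rightarrow> real^3"
  assumes "(a has_vector_derivative a') F" "(b has_vector_derivative b') F" "(c has_vector_derivative c') F"
  shows "((\<lambda>t. vector [a t, b t, c t] :: real^3^3) has_vector_derivative vector [a', b', c']) F"
  by (rule has_vector_derivative_vec_iff[THEN iffD2]) (simp add: forall_3 assms)

lemma continuous_on_four_block:
  fixes P :: "'a::topological_space \<Rightarrow> real^'n1^'m1" and Q :: "'a \<Rightarrow> real^'n2^'m1"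
    and S :: "'a \<Rightarrow> real^'n1^'m2" and T :: "'a \<Rightarrow> real^'n2^'m2"
  assumes "continuous_on A P" "continuous_on A Q" "continuous_on A S" "continuous_on A T"
  shows "continuous_on A (\<lambda>t. four_block (P t) (Q t) (S t) (T t))"
  unfolding four_block_def
proof (intro continuous_on_vec_lambda)
  fix i :: "'m1 + 'm2" and j :: "'n1 + 'n2"
  show "continuous_on A (\<lambda>t. case i of
       Inl a \<Rightarrow> (case j of Inl b \<Rightarrow> P t $ a $ b | Inr b \<Rightarrow> Q t $ a $ b)
     | Inr a \<Rightarrow> (case j of Inl b \<Rightarrow> S t $ a $ b | Inr b \<Rightarrow> T t $ a $ b))"
    by (cases i; cases j; simp) (intro continuous_on_component assms)+
qed

lemma continuous_on_stack:
  fixes P :: "'a::topological_space \<Rightarrow> real^'n^'m1" and Q :: "'a \<Rightarrow> real^'n^'m2"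
  assumes "continuous_on A P" "continuous_on A Q"
  shows "continuous_on A (\<lambda>t. stack (P t) (Q t))"
  unfolding stack_def
proof (intro continuous_on_vec_lambda)
  fix i :: "'m1 + 'm2" and j :: 'n
  show "continuous_on A (\<lambda>t. case i of Inl a \<Rightarrow> P t $ a $ j | Inr a \<Rightarrow> Q t $ a $ j)"
    by (cases i; simp) (intro continuous_on_component assms)+
qed

lemma continuous_on_rows_3:
  fixes a b c :: "'a::topological_space \<Rightarrow> real^3"
  assumes "continuous_on A a" "continuous_on A b" "continuous_on A c"
  shows "continuous_on A (\<lambda>t. vector [a t, b t, c t] :: real^3^3)"
proof -
  have eq: "(\<lambda>t. vector [a t, b t, c t] :: real^3^3) =
      (\<lambda>t. \<chi> i. if i = 1 then a t else if i = 2 then b t else c t)"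
    by (simp add: fun_eq_iff vec_eq_iff forall_3)
  have "continuous_on A (\<lambda>t. if i = 1 then a t else if i = 2 then b t else c t)" for i :: 3
    using assms by (cases "i = 1"; cases "i = 2") simp_all
  then show ?thesis unfolding eq by (rule continuous_on_vec_lambda)
qed

lemma bounded_linear_skew: "bounded_linear skew"
  unfolding linear_conv_bounded_linear[symmetric]
  by (intro linearI)
     (simp_all add: skew_def matrix_def vec_eq_iff cross_add_left cross_mult_left)

lemma bounded_bilinear_matrix_mult:
  "bounded_bilinear ((**) :: real^'n^'m \<Rightarrow> real^'k^'n \<Rightarrow> real^'k^'m)"
  unfolding bilinear_conv_bounded_bilinear[symmetric] bilinear_def linear_iff
  by (simp add: matrix_matrix_mult_def vec_eq_iff sum.distrib sum_distrib_left algebra_simps)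

lemma stack_mult:
  "(stack P Q *v x) $ Inl i = (P *v x) $ i" "(stack P Q *v x) $ Inr k = (Q *v x) $ k"
  by (simp_all add: stack_def matrix_vector_mult_def)

lemma four_block_mult:
  fixes P :: "'a::semiring_1^'n1^'m1"
  shows "(four_block P Q S T *v x) $ Inl i = (P *v lft x + Q *v rgt x) $ i"
    "(four_block P Q S T *v x) $ Inr k = (S *v lft x + T *v rgt x) $ k"
  by (simp_all add: four_block_def matrix_vector_mult_def lft_def rgt_def sum_UNIV_Plus)

lemma lft_rgt_four_block_mult:
  fixes P :: "'a::semiring_1^'n1^'m1"
  shows "lft (four_block P Q S T *v x) = P *v lft x + Q *v rgt x"
    "rgt (four_block P Q S T *v x) = S *v lft x + T *v rgt x"
  by (simp_all add: lft_def[of "_ *v _"] rgt_def[of "_ *v _"] four_block_mult vec_eq_iff)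

lemma axis_vector_matrix_mult: "axis k 1 v* (P :: real^'n^'m) = P $ k"
  by (simp add: vector_matrix_mult_def axis_def vec_eq_iff if_distrib[of "\<lambda>c. c * _"] if_distrib[of "\<lambda>c. _ * c"] sum.delta' cong: if_cong)

lemma skew_0 [simp]: "skew 0 = 0"
  using linear_0[OF bounded_linear.linear[OF bounded_linear_skew]] .

lemma skew_row_3: "skew u $ 3 \<bullet> x = e3 \<bullet> cross3 u x"
  by (simp add: matrix_vector_mul_component[symmetric] skew_mult inner_axis')

text \<open>\<open>vector_derivative\<close> is a choice among derivatives, so uniqueness is needed,
  also at 0. It holds because \<open>{0..}\<close> is connected and not a singleton, hence each of
  its points is a limit point.\<close>

lemma obs_M_eq:
  assumes "t \<ge> 0" "(C has_vector_derivative C') (at t within {0..})"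
  shows "obs_M A C t = stack (C t) (C t ** A t + C')"
proof -
  have "{0::real..} \<noteq> {x}" for x
    by (metis atLeast_iff singletonD zero_le_one order_refl zero_neq_one)
  then have "at t within {0..} \<noteq> bot"
    using connected_imp_perfect[of "{0::real..}" t] assms(1) by (auto simp: trivial_limit_within)
  from vector_derivative_within[OF this assms(2)] show ?thesis by (simp add: obs_M_def)
qed

lemma continuous_on_obs_M:
  fixes A C C' :: "real \<Rightarrow> real^(3+3)^(3+3)"
  assumes C: "\<And>t. t \<ge> 0 \<Longrightarrow> (C has_vector_derivative C' t) (at t within {0..})"
    and "continuous_on {0..} A" "continuous_on {0..} C'"
  shows "continuous_on {0..} (obs_M A C)"
proof -
  have "continuous_on {0..} C" using C by (intro continuous_on_vector_derivative) auto
  then have "continuous_on {0..} (\<lambda>t. stack (C t) (C t ** A t + C' t))"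
    by (intro continuous_on_stack continuous_on_add continuous_on_matrix_mult assms)
  then show ?thesis using obs_M_eq[OF _ C] by (subst continuous_on_cong[OF refl]) auto
qed

lemma obs_M_mult:
  assumes "t \<ge> 0" "(C has_vector_derivative C') (at t within {0..})"
  shows "(obs_M A C t *v x) $ Inl i = (C t *v x) $ i"
    "(obs_M A C t *v x) $ Inr k = (C t *v (A t *v x)) $ k + (C' *v x) $ k"
  by (simp_all add: obs_M_eq[OF assms] stack_mult matrix_vector_mult_add_rdistrib matrix_vector_mul_assoc)

lemma e3_row [simp]: "e3 v* P = P $ 3" for P :: "real^'n^3"
  by (rule axis_vector_matrix_mult)

lemma minus_matrix_vector_mult: "- P *v x = - (P *v x)" for P :: "'a::ring_1^'n^'m"
  by (simp add: matrix_vector_mult_def vec_eq_iff sum_negf)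

lemma rows_3_mult:
  fixes a b c :: "real^'n"
  defines "Q \<equiv> vector [a, b, c] :: real^'n^3"
  shows "(Q *v x) $ 1 = a \<bullet> x" "(Q *v x) $ 2 = b \<bullet> x" "(Q *v x) $ 3 = c \<bullet> x"
  by (simp_all add: Q_def matrix_vector_mul_component)

lemma not_3_cases: "i \<noteq> 3 \<Longrightarrow> i = 1 \<or> i = (2::3)"
  using exhaust_3 by blast

lemmas has_vector_derivative_skew = bounded_linear.has_vector_derivative[OF bounded_linear_skew]
lemmas has_vector_derivative_row = has_vector_derivative_vec_iff[THEN iffD1, rule_format]
lemmas has_vector_derivative_matrix_mult = bounded_bilinear.has_vector_derivative[OF bounded_bilinear_matrix_mult]

lemma continuous_on_skew:
  "continuous_on S u \<Longrightarrow> continuous_on S (\<lambda>t. skew (u t))"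
  by (rule bounded_linear.continuous_on[OF bounded_linear_skew])

section \<open>The two parametrizations\<close>

text \<open>The first two rows of \<open>C\<close> are constant: zero in the left block,
  \<open>e1\<close> and \<open>e2\<close> in the right one. Their derivatives vanish, so the
  matching rows of \<open>C ** A + C'\<close> are the first two rows of the lower half of
  \<open>A\<close>, which is the source of the gradient flow.\<close>

lemma uniform_observability_D_tilde:
  fixes R :: "real \<Rightarrow> real^3^3" and \<Omega> v v' :: "real \<Rightarrow> real^3" and m :: "real^3"
  assumes g: "g > 0" and m: "norm m = 1" "\<not> collinear {0, m, e3}"
    and R: "\<And>t. t \<ge> 0 \<Longrightarrow> rotation_matrix (R t)"
    and R': "\<And>t. t \<ge> 0 \<Longrightarrow> (R has_vector_derivative (R t ** skew (\<Omega> t))) (at t within {0..})"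
    and \<Omega>: "continuous_on {0..} \<Omega>"
    and v: "\<And>t. t \<ge> 0 \<Longrightarrow> (v has_vector_derivative v' t) (at t within {0..})" "continuous_on {0..} v'"
    and V: "\<And>t. t \<ge> 0 \<Longrightarrow> norm (v t) \<le> V"
    and W: "\<And>t. t \<ge> 0 \<Longrightarrow> norm (\<Omega> t) \<le> W"
    and \<rho>: "\<delta>0 > 0" "\<rho> > 0" "\<And>t. t \<ge> 0 \<Longrightarrow> (1 / \<delta>0) * integral {t..t + \<delta>0} (\<lambda>s. (R s $ 3 $ 3)\<^sup>2) \<ge> \<rho>\<^sup>2"
  defines "M \<equiv> obs_M (\<lambda>t. A_tilde g (R t) (\<Omega> t)) (\<lambda>t. C_tilde m (R t) (v t))"
  shows "continuous_on {0..} M"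
    and "\<exists>\<delta>>0. \<exists>\<mu>>0. \<forall>t\<ge>0. \<forall>x.
      \<mu> * (norm x)\<^sup>2 \<le> (1 / \<delta>) * integral {t..t + \<delta>} (\<lambda>s. (norm (M s *v x))\<^sup>2)"
proof -
  define C' where "C' t = four_block (vector [0, 0, - (skew (v' t) $ 3)] :: real^3^3)
      (vector [0, 0, (R t ** skew (\<Omega> t)) $ 3]) (0 :: real^3^3) 0" for t
  have C': "((\<lambda>t. C_tilde m (R t) (v t)) has_vector_derivative C' t) (at t within {0..})" if "t \<ge> 0" for t
    unfolding C_tilde_def Delta_def C'_def e3_row
    by (rule has_vector_derivative_four_block has_vector_derivative_rows_3 has_vector_derivative_const
        has_vector_derivative_minus has_vector_derivative_row has_vector_derivative_skew v R' that)+
  have contR: "continuous_on {0..} R" using R' by (intro continuous_on_vector_derivative) auto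
  have contA: "continuous_on {0..} (\<lambda>t. A_tilde g (R t) (\<Omega> t))"
    unfolding A_tilde_def
    by (intro continuous_on_four_block continuous_on_const continuous_on_scaleR continuous_on_minus
        continuous_on_matrix_mult continuous_on_transpose continuous_on_skew contR \<Omega>)
  have contC': "continuous_on {0..} C'"
    unfolding C'_def
    by (intro continuous_on_four_block continuous_on_rows_3 continuous_on_const continuous_on_minus
        continuous_on_component continuous_on_matrix_mult continuous_on_skew contR v \<Omega>)
  show contM: "continuous_on {0..} M" unfolding M_def by (rule continuous_on_obs_M[OF C' contA contC'])
  note M = obs_M_mult[OF _ C', where A = "\<lambda>t. A_tilde g (R t) (\<Omega> t)", folded M_def]
  show "\<exists>\<delta>>0. \<exists>\<mu>>0. \<forall>t\<ge>0. \<forall>x.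
      \<mu> * (norm x)\<^sup>2 \<le> (1 / \<delta>) * integral {t..t + \<delta>} (\<lambda>s. (norm (M s *v x))\<^sup>2)"
  proof (rule uniform_observability[where R = R and T = "\<lambda>t. mat 1" and \<omega> = "\<lambda>t. 0" and \<Omega> = \<Omega> and v = v,
        OF g m _ R' _ _ V W _ \<rho> contM])
    show "orthogonal_matrix (R t)" if "t \<ge> 0" for t using R[OF that] by (simp add: rotation_matrix_def)
    show "norm (0 :: real^3) \<le> W" using order_trans[OF norm_ge_zero W[of 0]] by simp
    fix t :: real and x :: "real^(3+3)" assume t: "t \<ge> 0"
    show "(M t *v x) $ Inl (Inl 3) = R t $ 3 \<bullet> rgt x - e3 \<bullet> cross3 (v t) (mat 1 *v lft x)"
      by (simp add: M[OF t t] C_tilde_def Delta_def four_block_mult rows_3_mult skew_row_3)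
    fix i :: 3
    show "(M t *v x) $ Inl (Inr i) = cross3 m (mat 1 *v lft x) $ i"
      by (simp add: M[OF t t] C_tilde_def four_block_mult skew_mult)
    assume i: "i \<noteq> 3"
    then show "(M t *v x) $ Inl (Inl i) = rgt x $ i"
      using not_3_cases[OF i]
      by (auto simp: M[OF t t] C_tilde_def Delta_def four_block_mult rows_3_mult inner_axis')
    show "(M t *v x) $ Inr (Inl i) =
      (g *\<^sub>R (transpose (R t) *v cross3 e3 (mat 1 *v lft x)) - cross3 (\<Omega> t) (rgt x)) $ i"
      using not_3_cases[OF i]
      by (auto simp: M[OF t t] C_tilde_def Delta_def A_tilde_def C'_def four_block_mult lft_rgt_four_block_mult
          rows_3_mult inner_axis' skew_mult minus_matrix_vector_mult scaleR_matrix_vector_assoc[symmetric]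
          matrix_vector_mul_assoc[symmetric])
  qed (simp_all add: orthogonal_matrix_id)
qed

lemma uniform_observability_D_bar:
  fixes R :: "real \<Rightarrow> real^3^3" and \<Omega> v v' :: "real \<Rightarrow> real^3" and m :: "real^3"
  assumes g: "g > 0" and m: "norm m = 1" "\<not> collinear {0, m, e3}"
    and R: "\<And>t. t \<ge> 0 \<Longrightarrow> rotation_matrix (R t)"
    and R': "\<And>t. t \<ge> 0 \<Longrightarrow> (R has_vector_derivative (R t ** skew (\<Omega> t))) (at t within {0..})"
    and \<Omega>: "continuous_on {0..} \<Omega>"
    and v: "\<And>t. t \<ge> 0 \<Longrightarrow> (v has_vector_derivative v' t) (at t within {0..})" "continuous_on {0..} v'"
    and V: "\<And>t. t \<ge> 0 \<Longrightarrow> norm (v t) \<le> V"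
    and W: "\<And>t. t \<ge> 0 \<Longrightarrow> norm (\<Omega> t) \<le> W"
    and \<rho>: "\<delta>0 > 0" "\<rho> > 0" "\<And>t. t \<ge> 0 \<Longrightarrow> (1 / \<delta>0) * integral {t..t + \<delta>0} (\<lambda>s. (R s $ 3 $ 3)\<^sup>2) \<ge> \<rho>\<^sup>2"
  defines "M \<equiv> obs_M (\<lambda>t. A_bar g (R t) (\<Omega> t)) (\<lambda>t. C_bar m (R t) (v t))"
  shows "continuous_on {0..} M"
    and "\<exists>\<delta>>0. \<exists>\<mu>>0. \<forall>t\<ge>0. \<forall>x.
      \<mu> * (norm x)\<^sup>2 \<le> (1 / \<delta>) * integral {t..t + \<delta>} (\<lambda>s. (norm (M s *v x))\<^sup>2)"
proof -
  \<comment> \<open>The summand \<open>0 ** R t\<close> is the derivative of the constant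
    \<open>skew m\<close> times \<open>R t\<close>; it keeps the exact shape produced by the product
    rule.\<close>
  define C' where "C' t = four_block
      (vector [0, 0, - ((skew (v t) ** (R t ** skew (\<Omega> t)) + skew (v' t) ** R t) $ 3)] :: real^3^3)
      (vector [0, 0, (R t ** skew (\<Omega> t)) $ 3])
      (skew m ** (R t ** skew (\<Omega> t)) + 0 ** R t) 0" for t
  have C': "((\<lambda>t. C_bar m (R t) (v t)) has_vector_derivative C' t) (at t within {0..})" if "t \<ge> 0" for t
    unfolding C_bar_def Delta_def C'_def e3_row
    by (rule has_vector_derivative_four_block has_vector_derivative_rows_3 has_vector_derivative_const
        has_vector_derivative_minus has_vector_derivative_row has_vector_derivative_matrix_mult
        has_vector_derivative_skew v R' that)+
  have contR: "continuous_on {0..} R" using R' by (intro continuous_on_vector_derivative) auto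
  have contv: "continuous_on {0..} v" using v(1) by (intro continuous_on_vector_derivative) auto
  have contA: "continuous_on {0..} (\<lambda>t. A_bar g (R t) (\<Omega> t))"
    unfolding A_bar_def
    by (intro continuous_on_four_block continuous_on_const continuous_on_scaleR continuous_on_minus
        continuous_on_matrix_vector_mult continuous_on_transpose continuous_on_skew contR \<Omega>)
  have contC': "continuous_on {0..} C'"
    unfolding C'_def
    by (intro continuous_on_four_block continuous_on_rows_3 continuous_on_const continuous_on_minus continuous_on_add
        continuous_on_component continuous_on_matrix_mult continuous_on_skew contR contv v \<Omega>)
  show contM: "continuous_on {0..} M" unfolding M_def by (rule continuous_on_obs_M[OF C' contA contC'])
  note M = obs_M_mult[OF _ C', where A = "\<lambda>t. A_bar g (R t) (\<Omega> t)", folded M_def]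
  have RO: "orthogonal_matrix (R t)" if "t \<ge> 0" for t using R[OF that] by (simp add: rotation_matrix_def)
  \<comment> \<open>Rotations commute with the cross product, for which determinant 1 matters: an
    orthogonal matrix alone would leave a sign. This rewrites the gravity block of
    \<open>A_bar\<close> in terms of \<open>R t *v lft x\<close>.\<close>
  have e3R: "cross3 (transpose (R t) *v e3) y = transpose (R t) *v cross3 e3 (R t *v y)" if "t \<ge> 0" for t y
  proof -
    have "R t *v (transpose (R t) *v e3) = e3" 
      using RO[OF that] unfolding matrix_vector_mul_assoc orthogonal_matrix_def by simp
    with cross_rotation_matrix[OF R[OF that], of "transpose (R t) *v e3" y]
    have "cross3 e3 (R t *v y) = R t *v cross3 (transpose (R t) *v e3) y" by simp
    then show ?thesis using RO[OF that] unfolding orthogonal_matrix_def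
      by (simp only: matrix_vector_mul_assoc) simp
  qed
  show "\<exists>\<delta>>0. \<exists>\<mu>>0. \<forall>t\<ge>0. \<forall>x.
      \<mu> * (norm x)\<^sup>2 \<le> (1 / \<delta>) * integral {t..t + \<delta>} (\<lambda>s. (norm (M s *v x))\<^sup>2)"
  proof (rule uniform_observability[where R = R and T = R and \<omega> = \<Omega> and \<Omega> = \<Omega> and v = v,
        OF g m RO R' RO R' V W W \<rho> contM])
    fix t :: real and x :: "real^(3+3)" assume t: "t \<ge> 0"
    have sk: "(skew (v t) ** R t) $ 3 \<bullet> y = e3 \<bullet> cross3 (v t) (R t *v y)" for y
      by (simp add: matrix_vector_mul_component[symmetric] matrix_vector_mul_assoc[symmetric] skew_mult inner_axis')
    show "(M t *v x) $ Inl (Inl 3) = R t $ 3 \<bullet> rgt x - e3 \<bullet> cross3 (v t) (R t *v lft x)"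
      by (simp add: M[OF t t] C_bar_def Delta_def four_block_mult rows_3_mult sk)
    fix i :: 3
    show "(M t *v x) $ Inl (Inr i) = cross3 m (R t *v lft x) $ i"
      by (simp add: M[OF t t] C_bar_def four_block_mult skew_mult matrix_vector_mul_assoc[symmetric])
    assume i: "i \<noteq> 3"
    then show "(M t *v x) $ Inl (Inl i) = rgt x $ i"
      using not_3_cases[OF i]
      by (auto simp: M[OF t t] C_bar_def Delta_def four_block_mult rows_3_mult inner_axis')
    show "(M t *v x) $ Inr (Inl i) =
      (g *\<^sub>R (transpose (R t) *v cross3 e3 (R t *v lft x)) - cross3 (\<Omega> t) (rgt x)) $ i"
      using not_3_cases[OF i] unfolding e3R[OF t, symmetric]
      by (auto simp: M[OF t t] C_bar_def Delta_def A_bar_def C'_def four_block_mult lft_rgt_four_block_mult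
          rows_3_mult inner_axis' skew_mult minus_matrix_vector_mult scaleR_matrix_vector_assoc[symmetric])
  qed
qed

theorem lemma4:
  fixes R :: "real \<Rightarrow> real^3^3" and \<Omega> v v' :: "real \<Rightarrow> real^3" and m :: "real^3"
    and g vmax \<Omega>max \<delta>0 \<rho> :: real and D :: "real \<Rightarrow> real^(3+3)^(3+3)"
  assumes "g > 0"
    and "m \<in> sphere 0 1" and "\<not> collinear {0, m, e3}"
    and "\<forall>t\<ge>0. rotation_matrix (R t)"
    and "\<forall>t\<ge>0. (R has_vector_derivative (R t ** skew (\<Omega> t))) (at t within {0..})"
    and "continuous_on {0..} \<Omega>"
    and "\<forall>t\<ge>0. (v has_vector_derivative v' t) (at t within {0..})"
    and "continuous_on {0..} v'"
    and "vmax > 0" and "\<forall>t\<ge>0. norm (v t) \<le> vmax"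
    and "\<Omega>max > 0" and "\<forall>t\<ge>0. norm (\<Omega> t) \<le> \<Omega>max"
    and "D = D_tilde g m R \<Omega> v \<or> D = D_bar g m R \<Omega> v"
    and "\<delta>0 > 0" and "\<rho> > 0"
    and "\<forall>t\<ge>0. (1 / \<delta>0) * integral {t..t + \<delta>0} (\<lambda>s. (R s $ 3 $ 3)\<^sup>2) \<ge> \<rho>\<^sup>2"
    and "(\<forall>t\<ge>0. cross3 (v t) e3 = 0)
       \<or> (\<forall>t\<ge>0. \<Omega> t = 0)
       \<or> vmax * \<Omega>max \<le> g * \<rho>\<^sup>2 / sqrt 6
       \<or> (\<exists>\<delta>b>0. \<exists>\<rho>b>0. \<forall>t\<ge>0.
            min ((1 / \<delta>b) * integral {t..t + \<delta>b} (\<lambda>s. (v' s $ 1)\<^sup>2))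
                ((1 / \<delta>b) * integral {t..t + \<delta>b} (\<lambda>s. (v' s $ 2)\<^sup>2)) \<ge> \<rho>b)"
  shows "\<exists>\<delta>>0. \<exists>\<mu>>0. \<forall>t>0.
           psd ((1 / \<delta>) *\<^sub>R integral {t..t + \<delta>} D - \<mu> *\<^sub>R mat 1)"
proof -
  have m: "norm m = 1" using assms(2) by simp
  note hyps = assms(1) m assms(3) assms(4,5)[rule_format] assms(6) assms(7)[rule_format] assms(8)
    assms(10)[rule_format] assms(12)[rule_format] assms(14,15) assms(16)[rule_format]
  \<comment> \<open>Hiding the parametrization behind an existential \<open>M\<close> leaves only
    the Gram form of \<open>D\<close> and a scalar bound, so the passage to the matrix inequality is
    made once.\<close>
  have "\<exists>M :: real \<Rightarrow> real^(3+3)^((3+3)+(3+3)). continuous_on {0..} M \<and> D = (\<lambda>s. transpose (M s) ** M s) \<and>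
      (\<exists>\<delta>>0. \<exists>\<mu>>0. \<forall>t\<ge>0. \<forall>x.
        \<mu> * (norm x)\<^sup>2 \<le> (1 / \<delta>) * integral {t..t + \<delta>} (\<lambda>s. (norm (M s *v x))\<^sup>2))"
    using assms(13)
  proof
    assume D: "D = D_tilde g m R \<Omega> v"
    show ?thesis
      by (intro exI[of _ "obs_M (\<lambda>t. A_tilde g (R t) (\<Omega> t)) (\<lambda>t. C_tilde m (R t) (v t))"]
          conjI uniform_observability_D_tilde[OF hyps]) (simp_all add: D D_tilde_def obs_D_def[abs_def])
  next
    assume D: "D = D_bar g m R \<Omega> v"
    show ?thesis
      by (intro exI[of _ "obs_M (\<lambda>t. A_bar g (R t) (\<Omega> t)) (\<lambda>t. C_bar m (R t) (v t))"]
          conjI uniform_observability_D_bar[OF hyps]) (simp_all add: D D_bar_def obs_D_def[abs_def])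
  qed
  then obtain M :: "real \<Rightarrow> real^(3+3)^((3+3)+(3+3))" and \<delta> \<mu> where M: "continuous_on {0..} M" "D = (\<lambda>s. transpose (M s) ** M s)"
    and \<delta>: "\<delta> > 0" "\<mu> > 0"
    and le: "\<And>t x. t \<ge> 0 \<Longrightarrow>
      \<mu> * (norm x)\<^sup>2 \<le> (1 / \<delta>) * integral {t..t + \<delta>} (\<lambda>s. (norm (M s *v x))\<^sup>2)"
    by blast
  have "psd ((1 / \<delta>) *\<^sub>R integral {t..t + \<delta>} D - \<mu> *\<^sub>R mat 1)" if "t > 0" for t
  proof (rule psd_integral_gram)
    show "continuous_on {t..t + \<delta>} M" using that by (intro continuous_on_subset[OF M(1)]) auto
    show "D s = transpose (M s) ** M s" for s by (simp add: M(2))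
    show "\<mu> * (norm x)\<^sup>2 \<le> (1 / \<delta>) * integral {t..t + \<delta>} (\<lambda>s. (norm (M s *v x))\<^sup>2)" for x
      using that by (intro le) simp
  qed
  then show ?thesis using \<delta> by blast
qed

end
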